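(* If $A$ is a complex Hermitian $n\times n$ matrix, then $C(A,z)\in\mathcal{H}_n(\mathbb{R})$ and $$C(A^{jj},z\setminus z_j)\ll C(A,z)$$ for $1\le j\le n$.
   Context: A polynomial $f\in\mathbb{C}[z_1,\ldots,z_n]$ is stable if $f(z_1,\ldots,z_n)\neq 0$ whenever $\operatorname{Im}(z_j)>0$ for all $1\le j\le n$; it is real stable if in addition it has real coefficients. $\mathcal{H}_n(\mathbb{C})$ and $\mathcal{H}_n(\mathbb{R})$ denote the sets of stable and real stable polynomials in $n$ variables. For $f,g\in\mathbb{R}[z_1,\ldots,z_n]$ write $f\ll g$ if $g+if\in\mathcal{H}_n(\mathbb{C})$. For an $n\times n$ complex matrix $A$ and $z=(z_1,\ldots,z_n)$, let $C(A,z)=\det(Z-A)\in\mathbb{C}[z_1,\ldots,z_n]$, where $Z=\operatorname{diag}(z_1,\ldots,z_n)$. $A^{jj}$ is the submatrix of $A$ obtained by deleting row $j$ and column $j$, and $z\setminus z_j=(z_1,\ldots,z_{j-1},z_{j+1},\ldots,z_n)$; $C(A^{jj},z\setminus z_j)$ is the corresponding determinantal polynomial in the remaining variables, regarded as a polynomial in $z_1,\ldots,z_n$ (equal to $1$ if $n=1$). *)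

theory Defs
  imports
    "HOL-Library.Poly_Mapping"
    "Jordan_Normal_Form.Determinant"
    "Jordan_Normal_Form.Schur_Decomposition"
begin

(* Complex polynomials in variables indexed by nat. A monomial is a finitely supported
   exponent function; the ring structure is the convolution product of Poly_Mapping.
   The variables z_1, ..., z_n are represented by the indices 0, ..., n - 1. *)
type_synonym cpoly = "(nat \<Rightarrow>\<^sub>0 nat) \<Rightarrow>\<^sub>0 complex"

definition Const :: "complex \<Rightarrow> cpoly" where
  "Const c = Poly_Mapping.single 0 c"

definition Var :: "nat \<Rightarrow> cpoly" where
  "Var i = Poly_Mapping.single (Poly_Mapping.single i 1) 1"

definition eval_cpoly :: "cpoly \<Rightarrow> (nat \<Rightarrow> complex) \<Rightarrow> complex" where
  "eval_cpoly f z =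
     (\<Sum>m\<in>Poly_Mapping.keys f. Poly_Mapping.lookup f m *
        (\<Prod>i\<in>Poly_Mapping.keys m. z i ^ Poly_Mapping.lookup m i))"

definition complex_polys :: "nat \<Rightarrow> cpoly set" where
  "complex_polys n = {f. \<forall>m\<in>Poly_Mapping.keys f. Poly_Mapping.keys m \<subseteq> {..<n}}"

definition real_polys :: "nat \<Rightarrow> cpoly set" where
  "real_polys n = {f \<in> complex_polys n. \<forall>m. Poly_Mapping.lookup f m \<in> \<real>}"

definition stable_polys :: "nat \<Rightarrow> cpoly set" where
  "stable_polys n =
     {f \<in> complex_polys n. \<forall>z. (\<forall>j<n. Im (z j) > 0) \<longrightarrow> eval_cpoly f z \<noteq> 0}"

definition real_stable_polys :: "nat \<Rightarrow> cpoly set" where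
  "real_stable_polys n = stable_polys n \<inter> real_polys n"

(* f << g; the relation is only meant for real polynomials, so membership in
   the real polynomial ring is part of the definition. *)
definition stable_ll :: "nat \<Rightarrow> cpoly \<Rightarrow> cpoly \<Rightarrow> bool" where
  "stable_ll n f g \<longleftrightarrow>
     f \<in> real_polys n \<and> g \<in> real_polys n \<and> g + Const \<i> * f \<in> stable_polys n"

definition hermitian_mat :: "complex mat \<Rightarrow> bool" where
  "hermitian_mat A \<longleftrightarrow> mat_adjoint A = A"

(* C(A, w) = det (diag(w_0, ..., w_(k-1)) - A) for a k x k matrix A and polynomials w_i *)
definition char_det :: "complex mat \<Rightarrow> (nat \<Rightarrow> cpoly) \<Rightarrow> cpoly" where
  "char_det A w = det (mat_diag (dim_row A) w - map_mat Const A)"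

definition omit :: "nat \<Rightarrow> (nat \<Rightarrow> 'a) \<Rightarrow> nat \<Rightarrow> 'a" where
  "omit j w = (\<lambda>i. if i < j then w i else w (Suc i))"

end

(* If det (diag z - A) vanished at a point of the upper half space, a kernel vector v would satisfy
   sum_i z_i |v_i|^2 = v^* A v; the right-hand side is real because A is Hermitian, while the left
   one has positive imaginary part. Coefficientwise conjugation turns C(A, z) into C(A^T, z), so the
   coefficients are real. By multilinearity of the determinant in row j, C(A, z) + i C(A^jj, z \ z_j)
   is C(A, z) with z_j replaced by z_j + i, and this shift preserves the upper half space. *)
theory Submission
  imports Defs
begin

section \<open>Reduction of additive statements to monomials\<close>

lemma poly_mapping_additive_induct [case_names zero single add]:
  fixes f :: "'a \<Rightarrow>\<^sub>0 'b::comm_monoid_add"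
  assumes "P 0" "\<And>k c. P (Poly_Mapping.single k c)" "\<And>f g. P f \<Longrightarrow> P g \<Longrightarrow> P (f + g)"
  shows "P f"
proof (induction f rule: Poly_Mapping.update_induct)
  case const
  then show ?case by (rule assms(1))
next
  case (update f a b)
  \<comment> \<open>The induction rule supplies a key \<open>a\<close> outside
    \<open>keys f\<close>, so the update overwrites a zero coefficient and amounts to adding one
    term.\<close>
  have "Poly_Mapping.update a b f = f + Poly_Mapping.single a b"
    by (rule poly_mapping_eqI)
      (use update(1) in \<open>auto simp: lookup_update lookup_add lookup_single when_def in_keys_iff\<close>)
  then show ?case using update assms by simp
qed

text \<open>Both sides are additive in \<open>f\<close> and in \<open>g\<close>, so comparing them
  on pairs of monomials suffices. This serves evaluation at a point as well as conjugation of
  coefficients.\<close>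

lemma additive_mult_hom_poly_mapping:
  fixes h :: "('a::monoid_add \<Rightarrow>\<^sub>0 'b::comm_ring_1) \<Rightarrow> 'c::comm_ring_1"
  assumes add: "\<And>f g. h (f + g) = h f + h g"
    and single: "\<And>k l a b. h (Poly_Mapping.single (k + l) (a * b))
      = h (Poly_Mapping.single k a) * h (Poly_Mapping.single l b)"
  shows "h (f * g) = h f * h g"
proof -
  have zero: "h 0 = 0" using add[of 0 0] by simp
  show ?thesis
  proof (induction f rule: poly_mapping_additive_induct)
    case zero
    then show ?case by (simp add: \<open>h 0 = 0\<close>)
  next
    case (single k a)
    show ?case
      by (induction g rule: poly_mapping_additive_induct)
        (auto simp: zero mult_single assms distrib_left)
  next
    case (add f g)
    then show ?case by (simp add: assms distrib_right)
  qed
qed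

section \<open>Evaluation at a point as a ring homomorphism\<close>

lemma eval_cpoly_superset:
  assumes "finite K" "Poly_Mapping.keys f \<subseteq> K"
  shows "eval_cpoly f z = (\<Sum>m\<in>K. Poly_Mapping.lookup f m *
    (\<Prod>i\<in>Poly_Mapping.keys m. z i ^ Poly_Mapping.lookup m i))"
  unfolding eval_cpoly_def
  by (rule sum.mono_neutral_left) (use assms in \<open>auto simp: in_keys_iff\<close>)

lemma eval_cpoly_add: "eval_cpoly (f + g) z = eval_cpoly f z + eval_cpoly g z"
proof -
  let ?K = "Poly_Mapping.keys f \<union> Poly_Mapping.keys g"
  have "Poly_Mapping.keys (f + g) \<subseteq> ?K" by (rule Poly_Mapping.keys_add)
  \<comment> \<open>Cancellation can make \<open>keys (f + g)\<close> smaller than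
    \<open>?K\<close>. All three evaluations are therefore rewritten over \<open>?K\<close>, where
    surplus keys have coefficient zero.\<close>
  then show ?thesis
    by (subst (1 2 3) eval_cpoly_superset[where K = ?K])
      (auto simp: lookup_add distrib_right sum.distrib)
qed

lemma eval_cpoly_single:
  "eval_cpoly (Poly_Mapping.single m c) z =
    c * (\<Prod>i\<in>Poly_Mapping.keys m. z i ^ Poly_Mapping.lookup m i)"
  by (subst eval_cpoly_superset[where K = "{m}"]) auto

text \<open>Outside \<open>keys m\<close> the exponent is \<open>0\<close> and the factor is
  \<open>1\<close>, even where \<open>z i = 0\<close>.\<close>

lemma monomial_eval_superset:
  fixes z :: "nat \<Rightarrow> complex"
  assumes "finite K" "Poly_Mapping.keys m \<subseteq> K"
  shows "(\<Prod>i\<in>Poly_Mapping.keys m. z i ^ Poly_Mapping.lookup m i) =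
    (\<Prod>i\<in>K. z i ^ Poly_Mapping.lookup m i)"
  by (rule prod.mono_neutral_left) (use assms in \<open>auto simp: in_keys_iff\<close>)

lemma monomial_eval_add:
  fixes z :: "nat \<Rightarrow> complex"
  shows "(\<Prod>i\<in>Poly_Mapping.keys (k + l). z i ^ Poly_Mapping.lookup (k + l) i) =
    (\<Prod>i\<in>Poly_Mapping.keys k. z i ^ Poly_Mapping.lookup k i) *
    (\<Prod>i\<in>Poly_Mapping.keys l. z i ^ Poly_Mapping.lookup l i)"
proof -
  let ?K = "Poly_Mapping.keys k \<union> Poly_Mapping.keys l"
  have "Poly_Mapping.keys (k + l) \<subseteq> ?K" by (rule Poly_Mapping.keys_add)
  then show ?thesis
    by (subst (1 2 3) monomial_eval_superset[where K = ?K])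
      (auto simp: lookup_add power_add prod.distrib)
qed

lemma comm_ring_hom_eval_cpoly: "comm_ring_hom (\<lambda>f. eval_cpoly f z)"
proof
  show "eval_cpoly (f * g) z = eval_cpoly f z * eval_cpoly g z" for f g
    by (rule additive_mult_hom_poly_mapping)
      (simp_all add: eval_cpoly_add eval_cpoly_single monomial_eval_add)
  show "eval_cpoly 1 z = 1"
    using eval_cpoly_single[of 0 1 z] by simp
  show "eval_cpoly 0 z = 0" by (simp add: eval_cpoly_def)
qed (rule eval_cpoly_add)

lemma eval_cpoly_Const [simp]: "eval_cpoly (Const c) z = c"
  by (simp add: Const_def eval_cpoly_single)

lemma eval_cpoly_Var [simp]: "eval_cpoly (Var i) z = z i"
  by (simp add: Var_def eval_cpoly_single)

text \<open>Determinants commute with ring homomorphisms applied entrywise. Keeping \<open>w\<close>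
  arbitrary covers both \<open>Var\<close> and \<open>omit j Var\<close>.\<close>

lemma eval_char_det:
  assumes "A \<in> carrier_mat n n"
  shows "eval_cpoly (char_det A w) z = det (mat_diag n (\<lambda>i. eval_cpoly (w i) z) - A)"
proof -
  interpret comm_ring_hom "\<lambda>f. eval_cpoly f z" by (rule comm_ring_hom_eval_cpoly)
  have "map_mat (\<lambda>f. eval_cpoly f z) (mat_diag (dim_row A) w - map_mat Const A) =
      mat_diag n (\<lambda>i. eval_cpoly (w i) z) - A"
    by (rule eq_matI) (use assms in \<open>auto simp: mat_diag_def hom_minus\<close>)
  then show ?thesis unfolding char_det_def by (metis hom_det)
qed

section \<open>Hermitian matrices and nonvanishing on the upper half space\<close>

lemma hermitian_mat_index:
  assumes "A \<in> carrier_mat n n" "hermitian_mat A" "i < n" "j < n"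
  shows "cnj (A $$ (i, j)) = A $$ (j, i)"
proof -
  have "A $$ (j, i) = mat_adjoint A $$ (j, i)" using assms by (simp add: hermitian_mat_def)
  also have "\<dots> = cnj (A $$ (i, j))"
    using assms(1,3,4) by (simp add: mat_adjoint_def mat_of_rows_def)
  finally show ?thesis by simp
qed

lemma hermitian_matI:
  assumes "A \<in> carrier_mat n n" "\<And>i j. i < n \<Longrightarrow> j < n \<Longrightarrow> cnj (A $$ (i, j)) = A $$ (j, i)"
  shows "hermitian_mat A"
  unfolding hermitian_mat_def
  by (rule eq_matI) (use assms in \<open>auto simp: mat_adjoint_def mat_of_rows_def\<close>)

lemma hermitian_mat_delete:
  assumes "A \<in> carrier_mat n n" "hermitian_mat A" "j < n"
  shows "hermitian_mat (mat_delete A j j)"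
  by (rule hermitian_matI[OF mat_delete_carrier[OF assms(1)]])
    (use assms hermitian_mat_index[OF assms(1,2)] in \<open>auto simp: mat_delete_def\<close>)

text \<open>Stated for a numerical point \<open>z\<close>, so that it applies to the given point and
  also to the one shifted by \<open>\<i>\<close> in a single coordinate.\<close>

lemma det_diag_minus_hermitian_nonzero:
  assumes A: "A \<in> carrier_mat n n" and herm: "hermitian_mat A"
    and z: "\<And>i. i < n \<Longrightarrow> Im (z i) > 0"
  shows "det (mat_diag n z - A) \<noteq> 0"
proof
  let ?M = "mat_diag n z - A"
  assume "det ?M = 0"
  moreover have M: "?M \<in> carrier_mat n n" using A by auto
  ultimately obtain v where v: "v \<in> carrier_vec n" "v \<noteq> 0\<^sub>v n" "?M *\<^sub>v v = 0\<^sub>v n"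
    using det_0_iff_vec_prod_zero_field by blast
  have row: "z i * v $ i = (\<Sum>j<n. A $$ (i, j) * v $ j)" if i: "i < n" for i
  proof -
    have "0 = (?M *\<^sub>v v) $ i" using v(3) i by simp
    also have "\<dots> = (\<Sum>j<n. (if i = j then z j * v $ j else 0) - A $$ (i, j) * v $ j)"
      using i A v(1)
      by (auto simp: scalar_prod_def mat_diag_def atLeast0LessThan algebra_simps intro!: sum.cong)
    also have "\<dots> = z i * v $ i - (\<Sum>j<n. A $$ (i, j) * v $ j)"
      using i by (simp add: sum_subtractf)
    finally show ?thesis by simp
  qed
  \<comment> \<open>This is the Hermitian form of \<open>A\<close> at the kernel vector. Conjugation
    exchanges the two indices, hence \<open>q\<close> is real.\<close>
  define q where "q = (\<Sum>i<n. \<Sum>j<n. cnj (v $ i) * A $$ (i, j) * v $ j)"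
  have "cnj q = (\<Sum>i<n. \<Sum>j<n. cnj (v $ j) * A $$ (j, i) * v $ i)"
    unfolding q_def using hermitian_mat_index[OF A herm]
    by (auto simp: cnj_sum algebra_simps intro!: sum.cong)
  also have "\<dots> = q" unfolding q_def by (rule sum.swap)
  finally have "Im q = 0" by (simp add: complex_eq_iff)
  moreover have "q = (\<Sum>i<n. z i * of_real ((cmod (v $ i))\<^sup>2))"
    unfolding q_def
  proof (rule sum.cong)
    fix i assume "i \<in> {..<n}"
    then have "(\<Sum>j<n. cnj (v $ i) * A $$ (i, j) * v $ j) = cnj (v $ i) * (z i * v $ i)"
      by (simp add: row sum_distrib_left mult.assoc)
    also have "\<dots> = z i * of_real ((cmod (v $ i))\<^sup>2)"
      by (metis complex_norm_square mult.commute mult.left_commute)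
    finally show "(\<Sum>j<n. cnj (v $ i) * A $$ (i, j) * v $ j) = z i * of_real ((cmod (v $ i))\<^sup>2)" .
  qed simp
  then have "Im q = (\<Sum>i<n. Im (z i) * (cmod (v $ i))\<^sup>2)" by simp
  moreover obtain k where "k < n" "v $ k \<noteq> 0" using v(1,2) by (metis carrier_vecD eq_vecI index_zero_vec)
  \<comment> \<open>All terms are nonnegative, and the one at the nonzero coordinate
    \<open>k\<close> is strictly positive.\<close>
  then have "0 < (\<Sum>i<n. Im (z i) * (cmod (v $ i))\<^sup>2)"
    using z by (intro sum_pos2[where i = k]) (auto simp: less_imp_le)
  ultimately show False by simp
qed

section \<open>Determinants stay in the polynomial ring\<close>

lemma det_in_subring:
  fixes M :: "'a::comm_ring_1 mat"
  assumes M: "M \<in> carrier_mat n n" and ent: "\<And>i j. i < n \<Longrightarrow> j < n \<Longrightarrow> M $$ (i, j) \<in> S"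
    and one: "1 \<in> S" and add: "\<And>x y. x \<in> S \<Longrightarrow> y \<in> S \<Longrightarrow> x + y \<in> S"
    and mult: "\<And>x y. x \<in> S \<Longrightarrow> y \<in> S \<Longrightarrow> x * y \<in> S" and uminus: "\<And>x. x \<in> S \<Longrightarrow> - x \<in> S"
  shows "det M \<in> S"
proof -
  have zero: "0 \<in> S" using add[OF one uminus[OF one]] by simp
  \<comment> \<open>For infinite \<open>I\<close> the sum defaults to \<open>0\<close> and the
    product below to \<open>1\<close>; both lie in \<open>S\<close>.\<close>
  have sum: "sum f I \<in> S" if "\<And>i. i \<in> I \<Longrightarrow> f i \<in> S" for f :: "(nat \<Rightarrow> nat) \<Rightarrow> 'a" and I
    using that by (induction I rule: infinite_finite_induct) (auto simp: zero add)
  have prod: "prod f I \<in> S" if "\<And>i. i \<in> I \<Longrightarrow> f i \<in> S" for f :: "nat \<Rightarrow> 'a" and I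
    using that by (induction I rule: infinite_finite_induct) (auto simp: one mult)
  have sgn: "signof p \<in> S" for p :: "nat \<Rightarrow> nat"
    by (simp add: sign_def one uminus)
  \<comment> \<open>The Leibniz formula builds the determinant from entries and signs by sums and
    products.\<close>
  show ?thesis
    unfolding det_def'[OF M]
    by (intro sum mult sgn prod ent) (auto simp: permutes_in_image)
qed

lemma complex_polys_add: "f \<in> complex_polys n \<Longrightarrow> g \<in> complex_polys n \<Longrightarrow> f + g \<in> complex_polys n"
  unfolding complex_polys_def using Poly_Mapping.keys_add[of f g] by blast

lemma complex_polys_uminus: "f \<in> complex_polys n \<Longrightarrow> - f \<in> complex_polys n"
  by (simp add: complex_polys_def)

lemma complex_polys_mult:
  assumes "f \<in> complex_polys n" "g \<in> complex_polys n"
  shows "f * g \<in> complex_polys n"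
  unfolding complex_polys_def
proof safe
  fix m i assume "m \<in> Poly_Mapping.keys (f * g)" and i: "i \<in> Poly_Mapping.keys m"
  then obtain a b where "a \<in> Poly_Mapping.keys f" "b \<in> Poly_Mapping.keys g" "m = a + b"
    using keys_mult[of f g] by blast
  then show "i < n"
    using i assms Poly_Mapping.keys_add[of a b] unfolding complex_polys_def by blast
qed

lemma Const_in_complex_polys: "Const c \<in> complex_polys n"
  by (simp add: complex_polys_def Const_def)

lemma Var_in_complex_polys: "i < n \<Longrightarrow> Var i \<in> complex_polys n"
  by (simp add: complex_polys_def Var_def)

lemma char_det_in_complex_polys:
  assumes A: "A \<in> carrier_mat k k" and w: "\<And>i. i < k \<Longrightarrow> w i \<in> complex_polys n"
  shows "char_det A w \<in> complex_polys n"
  unfolding char_det_def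
proof (rule det_in_subring[where n = k])
  show "mat_diag (dim_row A) w - map_mat Const A \<in> carrier_mat k k" using A by auto
  have "w i - Const c \<in> complex_polys n" if "i < k" for i c
    using complex_polys_add[OF w[OF that] complex_polys_uminus[OF Const_in_complex_polys]] by simp
  then show "(mat_diag (dim_row A) w - map_mat Const A) $$ (i, j) \<in> complex_polys n"
    if "i < k" "j < k" for i j
    using that A by (auto simp: mat_diag_def complex_polys_uminus Const_in_complex_polys)
  show "1 \<in> complex_polys n"
    using Const_in_complex_polys[of 1] by (simp add: Const_def)
qed (auto intro: complex_polys_add complex_polys_mult complex_polys_uminus)

section \<open>Conjugation of coefficients and real polynomials\<close>

definition cnj_poly :: "cpoly \<Rightarrow> cpoly" where
  "cnj_poly = Poly_Mapping.map cnj"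

lemma lookup_cnj_poly [simp]: "Poly_Mapping.lookup (cnj_poly f) m = cnj (Poly_Mapping.lookup f m)"
  by (simp add: cnj_poly_def map.rep_eq when_def)

lemma cnj_poly_single [simp]: "cnj_poly (Poly_Mapping.single m c) = Poly_Mapping.single m (cnj c)"
  by (rule poly_mapping_eqI) (simp add: lookup_single when_def)

lemma cnj_poly_add: "cnj_poly (f + g) = cnj_poly f + cnj_poly g"
  by (rule poly_mapping_eqI) (simp add: lookup_add)

text \<open>Exponents are untouched, so on monomials this is just multiplicativity of
  \<open>cnj\<close>.\<close>

lemma comm_ring_hom_cnj_poly: "comm_ring_hom cnj_poly"
proof
  show "cnj_poly (f * g) = cnj_poly f * cnj_poly g" for f g
    by (rule additive_mult_hom_poly_mapping) (simp_all add: cnj_poly_add mult_single)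
  show "cnj_poly 1 = 1" using cnj_poly_single[of 0 1] by simp
  show "cnj_poly 0 = 0" by (rule poly_mapping_eqI) simp
qed (rule cnj_poly_add)

lemma cnj_poly_Const [simp]: "cnj_poly (Const c) = Const (cnj c)"
  by (simp add: Const_def)

lemma cnj_poly_Var [simp]: "cnj_poly (Var i) = Var i"
  by (simp add: Var_def)

lemma cnj_poly_char_det:
  assumes A: "A \<in> carrier_mat k k" and herm: "hermitian_mat A"
    and w: "\<And>i. i < k \<Longrightarrow> cnj_poly (w i) = w i"
  shows "cnj_poly (char_det A w) = char_det A w"
proof -
  interpret comm_ring_hom cnj_poly by (rule comm_ring_hom_cnj_poly)
  let ?M = "mat_diag (dim_row A) w - map_mat Const A"
  have M: "?M \<in> carrier_mat k k" using A by auto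
  \<comment> \<open>Diagonal polynomials \<open>w i\<close> are fixed, and the entries of
    \<open>A\<close> are transposed by the Hermitian property.\<close>
  have "map_mat cnj_poly ?M = transpose_mat ?M"
    by (rule eq_matI)
      (use A w hermitian_mat_index[OF A herm] in \<open>auto simp: mat_diag_def hom_minus hom_uminus\<close>)
  then show ?thesis
    unfolding char_det_def by (metis hom_det det_transpose[OF M])
qed

text \<open>Variables are fixed by \<open>cnj_poly\<close>, so every coefficient equals its own
  conjugate. The assumption on \<open>w\<close> admits the full list of variables and the list with
  one omitted.\<close>

lemma char_det_in_real_polys:
  assumes A: "A \<in> carrier_mat k k" and herm: "hermitian_mat A"
    and w: "\<And>i. i < k \<Longrightarrow> w i \<in> Var ` {..<n}"
  shows "char_det A w \<in> real_polys n"
proof -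
  have "cnj_poly (char_det A w) = char_det A w"
    by (rule cnj_poly_char_det[OF A herm]) (auto dest: w)
  then have "cnj (Poly_Mapping.lookup (char_det A w) m) = Poly_Mapping.lookup (char_det A w) m" for m
    by (metis lookup_cnj_poly)
  moreover have "char_det A w \<in> complex_polys n"
    by (rule char_det_in_complex_polys[OF A]) (use imageE[OF w] Var_in_complex_polys in \<open>metis lessThan_iff\<close>)
  ultimately show ?thesis by (simp add: real_polys_def Reals_cnj_iff)
qed

section \<open>Change of one diagonal entry of a determinant\<close>

lemma det_add_diag_entry:
  fixes B :: "'a::comm_ring_1 mat"
  assumes B: "B \<in> carrier_mat n n" and B': "B' \<in> carrier_mat n n" and j: "j < n"
    and entries: "\<And>k l. k < n \<Longrightarrow> l < n \<Longrightarrow>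
      B' $$ (k, l) = (if k = j \<and> l = j then B $$ (k, l) + c else B $$ (k, l))"
  shows "det B' = det B + c * det (mat_delete B j j)"
proof -
  \<comment> \<open>The only altered entry lies in row \<open>j\<close>, which is deleted, so the
    cofactors along that row agree.\<close>
  have "mat_delete B' j l = mat_delete B j l" if "l < n" for l
    by (rule eq_matI) (use B B' entries in \<open>auto simp: mat_delete_def\<close>)
  then have cof: "cofactor B' j l = cofactor B j l" if "l < n" for l
    using that by (simp add: cofactor_def)
  have "det B' = (\<Sum>l<n. B' $$ (j, l) * cofactor B' j l)"
    by (rule laplace_expansion_row[OF B' j])
  also have "\<dots> = (\<Sum>l<n. B $$ (j, l) * cofactor B j l + (if l = j then c * cofactor B j l else 0))"
    by (rule sum.cong) (simp_all add: cof entries j distrib_right)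
  also have "\<dots> = det B + c * cofactor B j j"
    using j by (simp add: sum.distrib laplace_expansion_row[OF B j])
  \<comment> \<open>The cofactor sign at a diagonal position is
    \<open>(-1) ^ (j + j) = 1\<close>.\<close>
  finally show ?thesis by (simp add: cofactor_def)
qed

theorem theorem6p2:
  fixes A :: "complex mat" and n :: nat
  assumes "A \<in> carrier_mat n n"
    and "hermitian_mat A"
  shows "char_det A Var \<in> real_stable_polys n \<and>
    (\<forall>j<n. stable_ll n (char_det (mat_delete A j j) (omit j Var)) (char_det A Var))"
proof (intro conjI allI impI)
  note A = assms(1) and herm = assms(2)
  have real: "char_det A Var \<in> real_polys n"
    by (rule char_det_in_real_polys[OF A herm]) auto
  then show "char_det A Var \<in> real_stable_polys n"
    using det_diag_minus_hermitian_nonzero[OF A herm]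
    by (auto simp: real_stable_polys_def stable_polys_def real_polys_def eval_char_det[OF A])
  fix j assume j: "j < n"
  let ?D = "mat_delete A j j" and ?f = "char_det (mat_delete A j j) (omit j Var)"
  \<comment> \<open>For \<open>n = 1\<close> the submatrix is empty and \<open>?f\<close> is the
    constant \<open>1\<close>.\<close>
  have D: "?D \<in> carrier_mat (n - 1) (n - 1)" by (rule mat_delete_carrier[OF A])
  have real': "?f \<in> real_polys n"
    by (rule char_det_in_real_polys[OF D hermitian_mat_delete[OF A herm j]])
      (use j in \<open>auto simp: omit_def\<close>)
  have "eval_cpoly (char_det A Var + Const \<i> * ?f) z \<noteq> 0" if z: "\<forall>i<n. Im (z i) > 0" for z
  proof -
    interpret comm_ring_hom "\<lambda>f. eval_cpoly f z" by (rule comm_ring_hom_eval_cpoly)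
    let ?B = "mat_diag n z - A" and ?z = "z(j := z j + \<i>)"
    have B: "?B \<in> carrier_mat n n" using A by auto
    \<comment> \<open>Deletion skips index \<open>j\<close> in rows and columns exactly as
      \<open>omit j\<close> does in the list of variables.\<close>
    have del: "mat_delete ?B j j = mat_diag (n - 1) (omit j z) - ?D"
      by (rule eq_matI) (use A in \<open>auto simp: mat_delete_def mat_diag_def omit_def\<close>)
    have omit: "(\<lambda>i. eval_cpoly (omit j Var i) z) = omit j z"
      by (auto simp: omit_def)
    have "eval_cpoly (char_det A Var + Const \<i> * ?f) z = det ?B + \<i> * det (mat_delete ?B j j)"
      by (simp add: hom_add hom_mult eval_char_det[OF A] eval_char_det[OF D] del omit)
    \<comment> \<open>Here the diagonal increment \<open>c\<close> is \<open>\<i>\<close>, at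
      position \<open>j\<close>.\<close>
    also have "\<dots> = det (mat_diag n ?z - A)"
      by (rule det_add_diag_entry[symmetric, OF B _ j]) (use A in \<open>auto simp: mat_diag_def\<close>)
    also have "\<dots> \<noteq> 0"
      by (rule det_diag_minus_hermitian_nonzero[OF A herm]) (use z in \<open>auto intro: add_pos_pos\<close>)
    finally show ?thesis .
  qed
  moreover have "char_det A Var + Const \<i> * ?f \<in> complex_polys n"
    using real real'
    by (intro complex_polys_add complex_polys_mult Const_in_complex_polys) (auto simp: real_polys_def)
  ultimately show "stable_ll n ?f (char_det A Var)"
    using real real' by (auto simp: stable_ll_def stable_polys_def)
qed

end
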